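(* Let $(A,\Omega)$ be an algebra of finitary type. There is a one-to-one correspondence between the set $\mathrm{Con}(\mathcal P_{>0}^{<\omega}A)$ of all congruences of $(\mathcal P_{>0}^{<\omega}A,\Omega,\cup)$ and the set $\mathrm{Clo}(A)$. Namely, for all $\Theta\in\mathrm{Con}(\mathcal P_{>0}^{<\omega}A)$ and $\mathcal C\in\mathrm{Clo}(A)$, $$\Theta=\Upsilon_{\mathcal C_\Theta}\quad\text{and}\quad\mathcal C=\mathcal C_{\Upsilon_{\mathcal C}}.$$
   Context: $\mathcal P A$ is the set of all subsets of $A$, $\mathcal P_{>0}^{<\omega}A$ the set of all finite non-empty subsets of $A$. Each $n$-ary $\omega\in\Omega$ acts on subsets as the complex operation $\omega(A_1,\dots,A_n)=\{\omega(a_1,\dots,a_n)\mid a_i\in A_i\}$, giving the algebra $(\mathcal P_{>0}^{<\omega}A,\Omega,\cup)$. For an equivalence relation $\Theta$ on $\mathcal P_{>0}^{<\omega}A$ define $\mathcal C_\Theta:\mathcal P A\to\mathcal P A$ by $\mathcal C_\Theta(T)=\{a\in A\mid \exists U\in\mathcal P_{>0}^{<\omega}T:\ U\cup\{a\}\mathrel{\Theta}U\}$. For an operator $\mathcal C:\mathcal P A\to\mathcal P A$ define the relation $\Upsilon_{\mathcal C}$ on $\mathcal P_{>0}^{<\omega}A$ by $(Q,R)\in\Upsilon_{\mathcal C}\Leftrightarrow\mathcal C(Q)=\mathcal C(R)$. $\mathrm{Clo}(A)$ is the set of all closure operators $\mathcal C$ on $A$ that are algebraic ($\mathcal C(B)=\bigcup\{\mathcal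 C(F)\mid F\in\mathcal P_{>0}^{<\omega}B\}$ for all $B\subseteq A$), $\varnothing$-preserving ($\mathcal C(\varnothing)=\varnothing$), and satisfy $\omega(\mathcal C(T_1),\dots,\mathcal C(T_n))\subseteq\mathcal C(\omega(T_1,\dots,T_n))$ for every $n$-ary $\omega\in\Omega$ with $n>0$ and all $T_1,\dots,T_n\in\mathcal P_{>0}^{<\omega}A$. *)

theory Defs
  imports Main "HOL-Library.FuncSet"
begin

text \<open>An algebra of finitary type is given by a carrier set \<open>A\<close>, a set \<open>\<Omega>\<close> of operation symbols,
  an arity function \<open>ar\<close>, and an interpretation \<open>I\<close>; the value \<open>I w xs\<close> is only meaningful for lists
  \<open>xs\<close> over \<open>A\<close> of length \<open>ar w\<close>. The set of symbols may be empty, and constants are allowed.\<close>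

definition finitary_algebra ::
    "'a set \<Rightarrow> 'w set \<Rightarrow> ('w \<Rightarrow> nat) \<Rightarrow> ('w \<Rightarrow> 'a list \<Rightarrow> 'a) \<Rightarrow> bool" where
  "finitary_algebra A \<Omega> ar I \<longleftrightarrow>
     (\<forall>w\<in>\<Omega>. \<forall>xs. length xs = ar w \<and> set xs \<subseteq> A \<longrightarrow> I w xs \<in> A)"

definition congruence ::
    "'a set \<Rightarrow> 'w set \<Rightarrow> ('w \<Rightarrow> nat) \<Rightarrow> ('w \<Rightarrow> 'a list \<Rightarrow> 'a) \<Rightarrow> ('a \<times> 'a) set \<Rightarrow> bool" where
  "congruence A \<Omega> ar I \<Theta> \<longleftrightarrow>
     equiv A \<Theta> \<and>
     (\<forall>w\<in>\<Omega>. \<forall>xs ys. length xs = ar w \<and> length ys = ar w \<and>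
        list_all2 (\<lambda>x y. (x, y) \<in> \<Theta>) xs ys \<longrightarrow> (I w xs, I w ys) \<in> \<Theta>)"

definition fin_pow :: "'a set \<Rightarrow> 'a set set" where
  "fin_pow A = {Q. Q \<subseteq> A \<and> finite Q \<and> Q \<noteq> {}}"

text \<open>The sets \<open>A\<^sub>1, \<dots>, A\<^sub>n\<close> are passed as a list, and \<open>listset [A\<^sub>1, \<dots>, A\<^sub>n]\<close> is their cartesian
  product. For a constant the result is the singleton of its value.\<close>

definition complex_op :: "('a list \<Rightarrow> 'a) \<Rightarrow> 'a set list \<Rightarrow> 'a set" where
  "complex_op f As = f ` listset As"

definition Con ::
    "'a set \<Rightarrow> 'w set \<Rightarrow> ('w \<Rightarrow> nat) \<Rightarrow> ('w \<Rightarrow> 'a list \<Rightarrow> 'a) \<Rightarrow> ('a set \<times> 'a set) set set" where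
  "Con A \<Omega> ar I =
     {\<Theta>. congruence (fin_pow A) \<Omega> ar (\<lambda>w. complex_op (I w)) \<Theta> \<and>
          (\<forall>Q Q' R R'. (Q, Q') \<in> \<Theta> \<and> (R, R') \<in> \<Theta> \<longrightarrow> (Q \<union> R, Q' \<union> R') \<in> \<Theta>)}"

text \<open>Operators on the subsets of \<open>A\<close> are functions on a type of sets, made extensional on
  \<open>Pow A\<close> so that two operators agreeing on all subsets of \<open>A\<close> are equal.\<close>

definition closure_operator :: "'a set \<Rightarrow> ('a set \<Rightarrow> 'a set) \<Rightarrow> bool" where
  "closure_operator A C \<longleftrightarrow>
     C \<in> Pow A \<rightarrow>\<^sub>E Pow A \<and>
     (\<forall>T\<in>Pow A. T \<subseteq> C T) \<and>
     (\<forall>S\<in>Pow A. \<forall>T\<in>Pow A. S \<subseteq> T \<longrightarrow> C S \<subseteq> C T) \<and>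
     (\<forall>T\<in>Pow A. C (C T) = C T)"

definition Clo ::
    "'a set \<Rightarrow> 'w set \<Rightarrow> ('w \<Rightarrow> nat) \<Rightarrow> ('w \<Rightarrow> 'a list \<Rightarrow> 'a) \<Rightarrow> ('a set \<Rightarrow> 'a set) set" where
  "Clo A \<Omega> ar I =
     {C. closure_operator A C \<and>
         (\<forall>B\<in>Pow A. C B = (\<Union>F\<in>fin_pow B. C F)) \<and>
         C {} = {} \<and>
         (\<forall>w\<in>\<Omega>. ar w > 0 \<longrightarrow>
            (\<forall>Ts. length Ts = ar w \<and> set Ts \<subseteq> fin_pow A \<longrightarrow>
               complex_op (I w) (map C Ts) \<subseteq> C (complex_op (I w) Ts)))}"

definition op_of_rel :: "'a set \<Rightarrow> ('a set \<times> 'a set) set \<Rightarrow> 'a set \<Rightarrow> 'a set" where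
  "op_of_rel A \<Theta> = (\<lambda>T\<in>Pow A. {a \<in> A. \<exists>U\<in>fin_pow T. (U \<union> {a}, U) \<in> \<Theta>})"

definition rel_of_op :: "'a set \<Rightarrow> ('a set \<Rightarrow> 'a set) \<Rightarrow> ('a set \<times> 'a set) set" where
  "rel_of_op A C = {(Q, R). Q \<in> fin_pow A \<and> R \<in> fin_pow A \<and> C Q = C R}"

end

theory Submission
  imports Defs
begin

text \<open>For a congruence \<open>\<Theta>\<close> with operator \<open>C\<close>, compatibility with unions shows that a witness \<open>U\<close> of
  \<open>a \<in> C T\<close> can be replaced by any finite subset of \<open>T\<close> containing it. Hence on finite \<open>T\<close> the condition
  \<open>F \<subseteq> C T\<close> (\<open>F\<close> finite) means \<open>T \<union> F \<Theta> T\<close>, and \<open>Q \<Theta> R\<close> is equivalent to \<open>C Q = C R\<close>, since the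
  latter makes both \<open>Q\<close> and \<open>R\<close> congruent to \<open>Q \<union> R\<close>. Compatibility with an operation transfers by
  comparing \<open>\<omega>(T\<^sub>1 \<union> {x\<^sub>1}, \<dots>, T\<^sub>n \<union> {x\<^sub>n})\<close> with \<open>\<omega>(T\<^sub>1, \<dots>, T\<^sub>n)\<close>. Conversely, algebraicity recovers
  a closure operator from its values on finite sets.\<close>

section \<open>Products of lists of sets and complex operations\<close>

lemma in_listset_iff: "xs \<in> listset As \<longleftrightarrow> list_all2 (\<in>) xs As"
  by (induction As arbitrary: xs) (auto simp: set_Cons_def list_all2_Cons2)

lemma listset_mono: "list_all2 (\<subseteq>) As Bs \<Longrightarrow> listset As \<subseteq> listset Bs"
  by (auto simp: in_listset_iff list_all2_conv_all_nth subset_iff)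

lemma finite_listset: "(\<And>X. X \<in> set As \<Longrightarrow> finite X) \<Longrightarrow> finite (listset As)"
proof (induction As)
  case (Cons X As)
  have "listset (X # As) = (\<lambda>(x, xs). x # xs) ` (X \<times> listset As)"
    by (auto simp: set_Cons_def)
  with Cons show ?case by simp
qed simp

lemma listset_ne: "(\<And>X. X \<in> set As \<Longrightarrow> X \<noteq> {}) \<Longrightarrow> listset As \<noteq> {}"
proof (induction As)
  case (Cons X As)
  then obtain x xs where "x \<in> X" "xs \<in> listset As" by fastforce
  then have "x # xs \<in> listset (X # As)" by (simp add: set_Cons_def)
  then show ?case by blast
qed simp

lemma complex_op_mono: "list_all2 (\<subseteq>) As Bs \<Longrightarrow> complex_op f As \<subseteq> complex_op f Bs"
  unfolding complex_op_def by (intro image_mono listset_mono)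

text \<open>The argument lists form a finite nonempty product, since every factor is finite and
  nonempty; for a constant the product contains just the empty list. This makes the complex
  operations act on \<open>fin_pow A\<close>.\<close>

lemma complex_op_fin_pow:
  assumes "finitary_algebra A \<Omega> ar I" "w \<in> \<Omega>" "length Ts = ar w" "set Ts \<subseteq> fin_pow A"
  shows "complex_op (I w) Ts \<in> fin_pow A"
proof -
  have "I w xs \<in> A" if "xs \<in> listset Ts" for xs
  proof -
    from that have l: "list_all2 (\<in>) xs Ts" by (simp add: in_listset_iff)
    then have "length xs = ar w" using assms(3) by (simp add: list_all2_lengthD)
    moreover have "set xs \<subseteq> A"
      using l assms(4) by (fastforce simp: list_all2_conv_all_nth fin_pow_def in_set_conv_nth)
    ultimately show ?thesis using assms(1,2) by (simp add: finitary_algebra_def)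
  qed
  moreover have "finite (listset Ts)" "listset Ts \<noteq> {}"
    using assms(4) by (intro finite_listset listset_ne; auto simp: fin_pow_def)+
  ultimately show ?thesis by (auto simp: fin_pow_def complex_op_def)
qed

lemma fin_pow_mono: "S \<subseteq> T \<Longrightarrow> fin_pow S \<subseteq> fin_pow T"
  by (auto simp: fin_pow_def)

lemma fin_pow_Un: "Q \<in> fin_pow A \<Longrightarrow> R \<in> fin_pow A \<Longrightarrow> Q \<union> R \<in> fin_pow A"
  by (auto simp: fin_pow_def)

section \<open>The operator of a congruence\<close>

context
  fixes A :: "'a set" and \<Omega> :: "'w set" and ar :: "'w \<Rightarrow> nat" and I :: "'w \<Rightarrow> 'a list \<Rightarrow> 'a"
    and \<Theta> :: "('a set \<times> 'a set) set"
  assumes \<Theta>: "\<Theta> \<in> Con A \<Omega> ar I"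
begin

lemma Con_refl: "Q \<in> fin_pow A \<Longrightarrow> (Q, Q) \<in> \<Theta>"
  using \<Theta> by (auto simp: Con_def congruence_def equiv_def refl_on_def)

lemma Con_sym: "(Q, R) \<in> \<Theta> \<Longrightarrow> (R, Q) \<in> \<Theta>"
  using \<Theta> by (auto simp: Con_def congruence_def equiv_def dest: symD)

lemma Con_trans: "(Q, R) \<in> \<Theta> \<Longrightarrow> (R, S) \<in> \<Theta> \<Longrightarrow> (Q, S) \<in> \<Theta>"
  using \<Theta> by (auto simp: Con_def congruence_def equiv_def dest: transD)

lemma Con_Un: "(Q, Q') \<in> \<Theta> \<Longrightarrow> (R, R') \<in> \<Theta> \<Longrightarrow> (Q \<union> R, Q' \<union> R') \<in> \<Theta>"
  using \<Theta> by (auto simp: Con_def)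

lemma Con_fin_pow:
  assumes "(Q, R) \<in> \<Theta>"
  shows "Q \<in> fin_pow A" "R \<in> fin_pow A"
proof -
  have "\<Theta> \<subseteq> fin_pow A \<times> fin_pow A"
    using \<Theta> by (auto simp: Con_def congruence_def dest: equiv_type)
  then show "Q \<in> fin_pow A" "R \<in> fin_pow A" using assms by auto
qed

lemma op_of_rel_iff:
  "T \<subseteq> A \<Longrightarrow> a \<in> op_of_rel A \<Theta> T \<longleftrightarrow> a \<in> A \<and> (\<exists>U\<in>fin_pow T. (U \<union> {a}, U) \<in> \<Theta>)"
  by (simp add: op_of_rel_def)

text \<open>A finite nonempty \<open>T\<close> can serve as its own witness: joining
  \<open>T\<close> to both sides of the pair for a smaller witness \<open>U\<close> absorbs
  \<open>U\<close> into \<open>T\<close>.\<close>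

lemma op_of_rel_fin_iff:
  assumes T: "T \<in> fin_pow A"
  shows "a \<in> op_of_rel A \<Theta> T \<longleftrightarrow> (T \<union> {a}, T) \<in> \<Theta>"
proof
  have TA: "T \<subseteq> A" using T by (simp add: fin_pow_def)
  { assume "a \<in> op_of_rel A \<Theta> T"
    then obtain U where U: "U \<in> fin_pow T" "(U \<union> {a}, U) \<in> \<Theta>"
      using op_of_rel_iff[OF TA] by auto
    have "T \<union> (U \<union> {a}) = T \<union> {a}" "T \<union> U = T" using U(1) by (auto simp: fin_pow_def)
    with Con_Un[OF Con_refl[OF T] U(2)] show "(T \<union> {a}, T) \<in> \<Theta>" by simp }
  { assume *: "(T \<union> {a}, T) \<in> \<Theta>"
    then have "a \<in> A" using Con_fin_pow(1) by (auto simp: fin_pow_def)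
    moreover have "T \<in> fin_pow T" using T by (auto simp: fin_pow_def)
    ultimately show "a \<in> op_of_rel A \<Theta> T" using * op_of_rel_iff[OF TA] by blast }
qed

text \<open>Elements are added one at a time: the pairs for \<open>F\<close> and for
  \<open>{a}\<close> are joined, and idempotence of union turns \<open>T \<union> T\<close> back
  into \<open>T\<close>.\<close>

lemma Con_absorb:
  assumes T: "T \<in> fin_pow A" and F: "finite F" "F \<subseteq> op_of_rel A \<Theta> T"
  shows "(T \<union> F, T) \<in> \<Theta>"
  using F
proof (induction F)
  case empty
  then show ?case using Con_refl[OF T] by simp
next
  case (insert a F)
  then have "(T \<union> {a}, T) \<in> \<Theta>" using op_of_rel_fin_iff[OF T] by simp
  with insert have "((T \<union> F) \<union> (T \<union> {a}), T \<union> T) \<in> \<Theta>" by (intro Con_Un) auto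
  then show ?case by (simp add: Un_ac)
qed

lemma op_of_rel_subset: "T \<subseteq> A \<Longrightarrow> op_of_rel A \<Theta> T \<subseteq> A"
  by (auto simp: op_of_rel_iff)

lemma op_of_rel_increasing:
  assumes "T \<subseteq> A" shows "T \<subseteq> op_of_rel A \<Theta> T"
proof
  fix a assume "a \<in> T"
  then have "{a} \<in> fin_pow T" "{a} \<in> fin_pow A" using assms by (auto simp: fin_pow_def)
  moreover from this(2) have "({a} \<union> {a}, {a}) \<in> \<Theta>" using Con_refl by simp
  ultimately show "a \<in> op_of_rel A \<Theta> T"
    using \<open>a \<in> T\<close> assms op_of_rel_iff[OF assms] by blast
qed

lemma op_of_rel_mono:
  assumes "S \<subseteq> T" "T \<subseteq> A" shows "op_of_rel A \<Theta> S \<subseteq> op_of_rel A \<Theta> T"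
  using fin_pow_mono[OF assms(1)] op_of_rel_iff[OF assms(2)]
    op_of_rel_iff[OF subset_trans[OF assms]] by blast

text \<open>From left to right, congruent sets may be exchanged in the pair that expresses
  membership of \<open>a\<close>. From right to left, each set lies in the operator of the other, so
  both absorb each other and are congruent to their union.\<close>

lemma rel_iff_op_of_rel_eq:
  assumes Q: "Q \<in> fin_pow A" and R: "R \<in> fin_pow A"
  shows "(Q, R) \<in> \<Theta> \<longleftrightarrow> op_of_rel A \<Theta> Q = op_of_rel A \<Theta> R"
proof
  \<comment> \<open>\<open>Q\<close> and \<open>R\<close> are bound afresh here, so that symmetry of
    \<Theta> yields the reverse inclusion.\<close>
  have sub: "op_of_rel A \<Theta> Q \<subseteq> op_of_rel A \<Theta> R" if QR: "(Q, R) \<in> \<Theta>" for Q R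
  proof
    note fin = Con_fin_pow[OF QR]
    fix a assume "a \<in> op_of_rel A \<Theta> Q"
    then have a: "(Q \<union> {a}, Q) \<in> \<Theta>" using op_of_rel_fin_iff fin by simp
    then have "{a} \<in> fin_pow A" using Con_fin_pow(1)[OF a] by (auto simp: fin_pow_def)
    then have "(R \<union> {a}, Q \<union> {a}) \<in> \<Theta>" by (rule Con_Un[OF Con_sym[OF QR] Con_refl])
    then have "(R \<union> {a}, R) \<in> \<Theta>" using a QR Con_trans by blast
    then show "a \<in> op_of_rel A \<Theta> R" using op_of_rel_fin_iff fin by simp
  qed
  show "op_of_rel A \<Theta> Q = op_of_rel A \<Theta> R" if "(Q, R) \<in> \<Theta>"
    using that sub Con_sym by blast
  assume eq: "op_of_rel A \<Theta> Q = op_of_rel A \<Theta> R"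
  have QR: "Q \<subseteq> A" "R \<subseteq> A" "finite Q" "finite R" using Q R by (auto simp: fin_pow_def)
  have "R \<subseteq> op_of_rel A \<Theta> Q" "Q \<subseteq> op_of_rel A \<Theta> R"
    using op_of_rel_increasing[OF QR(1)] op_of_rel_increasing[OF QR(2)] eq by simp_all
  then have "(Q \<union> R, Q) \<in> \<Theta>" "(R \<union> Q, R) \<in> \<Theta>"
    using Con_absorb[OF Q QR(4)] Con_absorb[OF R QR(3)] by simp_all
  then show "(Q, R) \<in> \<Theta>" using Con_sym Con_trans by (metis Un_commute)
qed

text \<open>The witness \<open>U\<close> in the definition of the operator is itself a finite subset
  of \<open>T\<close> whose operator value contains the element.\<close>

lemma op_of_rel_algebraic:
  assumes "T \<subseteq> A" shows "op_of_rel A \<Theta> T = (\<Union>F\<in>fin_pow T. op_of_rel A \<Theta> F)"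
proof
  show "op_of_rel A \<Theta> T \<subseteq> (\<Union>F\<in>fin_pow T. op_of_rel A \<Theta> F)"
  proof
    fix a assume "a \<in> op_of_rel A \<Theta> T"
    then obtain U where U: "U \<in> fin_pow T" "(U \<union> {a}, U) \<in> \<Theta>"
      using op_of_rel_iff[OF assms] by auto
    then have "a \<in> op_of_rel A \<Theta> U" using op_of_rel_fin_iff Con_fin_pow(2) by blast
    with U(1) show "a \<in> (\<Union>F\<in>fin_pow T. op_of_rel A \<Theta> F)" by blast
  qed
  show "(\<Union>F\<in>fin_pow T. op_of_rel A \<Theta> F) \<subseteq> op_of_rel A \<Theta> T"
    by (intro UN_least op_of_rel_mono[OF _ assms]) (simp add: fin_pow_def)
qed

text \<open>The union of one witness for each element of \<open>F\<close> is again finite, and by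
  monotonicity it serves all of \<open>F\<close> at once. Idempotence relies on such a common
  witness.\<close>

lemma op_of_rel_finite_subset:
  assumes T: "T \<subseteq> A" and F: "F \<in> fin_pow (op_of_rel A \<Theta> T)"
  obtains V where "V \<in> fin_pow T" "F \<subseteq> op_of_rel A \<Theta> V"
proof -
  have "\<forall>a\<in>F. \<exists>U. U \<in> fin_pow T \<and> a \<in> op_of_rel A \<Theta> U"
  proof
    fix a assume "a \<in> F"
    then have "a \<in> op_of_rel A \<Theta> T" using F by (auto simp: fin_pow_def)
    then show "\<exists>U. U \<in> fin_pow T \<and> a \<in> op_of_rel A \<Theta> U"
      unfolding op_of_rel_algebraic[OF T] by blast
  qed
  then obtain U where U: "\<And>a. a \<in> F \<Longrightarrow> U a \<in> fin_pow T \<and> a \<in> op_of_rel A \<Theta> (U a)"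
    by metis
  have "finite F" "F \<noteq> {}" using F by (simp_all add: fin_pow_def)
  moreover have "U a \<subseteq> T \<and> finite (U a) \<and> U a \<noteq> {}" if "a \<in> F" for a
    using U[OF that] by (simp add: fin_pow_def)
  ultimately have "\<Union> (U ` F) \<in> fin_pow T" by (auto simp: fin_pow_def)
  moreover have "F \<subseteq> op_of_rel A \<Theta> (\<Union> (U ` F))"
  proof
    fix a assume a: "a \<in> F"
    have "\<Union> (U ` F) \<subseteq> A" using \<open>\<Union> (U ` F) \<in> fin_pow T\<close> T by (auto simp: fin_pow_def)
    then show "a \<in> op_of_rel A \<Theta> (\<Union> (U ` F))"
      using U[OF a] a op_of_rel_mono[of "U a" "\<Union> (U ` F)"] by blast
  qed
  ultimately show ?thesis by (rule that)
qed

lemma op_of_rel_idem: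
  assumes T: "T \<subseteq> A" shows "op_of_rel A \<Theta> (op_of_rel A \<Theta> T) = op_of_rel A \<Theta> T"
proof
  note CT = op_of_rel_subset[OF T]
  show "op_of_rel A \<Theta> T \<subseteq> op_of_rel A \<Theta> (op_of_rel A \<Theta> T)"
    using CT by (rule op_of_rel_increasing)
  show "op_of_rel A \<Theta> (op_of_rel A \<Theta> T) \<subseteq> op_of_rel A \<Theta> T"
  proof
    fix a assume "a \<in> op_of_rel A \<Theta> (op_of_rel A \<Theta> T)"
    then obtain U where U: "U \<in> fin_pow (op_of_rel A \<Theta> T)" "a \<in> op_of_rel A \<Theta> U"
      using op_of_rel_algebraic[OF CT] by auto
    obtain V where V: "V \<in> fin_pow T" "U \<subseteq> op_of_rel A \<Theta> V"
      using op_of_rel_finite_subset[OF T U(1)] .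
    have VA: "V \<in> fin_pow A" using V(1) fin_pow_mono[OF T] by auto
    have UA: "U \<in> fin_pow A" using U(1) fin_pow_mono[OF CT] by auto
    \<comment> \<open>\<open>V\<close> absorbs \<open>U\<close>, so passing from \<open>V\<close> to
      \<open>V \<union> U\<close> does not change the operator value, which by monotonicity contains
      \<open>a\<close>.\<close>
    have "(V \<union> U, V) \<in> \<Theta>" using V(2) UA VA by (intro Con_absorb) (auto simp: fin_pow_def)
    then have "op_of_rel A \<Theta> (V \<union> U) = op_of_rel A \<Theta> V"
      using rel_iff_op_of_rel_eq UA VA fin_pow_Un by blast
    moreover have "a \<in> op_of_rel A \<Theta> (V \<union> U)"
      using U(2) op_of_rel_mono[of U "V \<union> U"] UA VA by (auto simp: fin_pow_def)
    ultimately show "a \<in> op_of_rel A \<Theta> T"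
      using op_of_rel_algebraic[OF T] V(1) by auto
  qed
qed

text \<open>A value \<open>I w xs\<close> with entries from the closures lies in a complex product
  of slightly larger sets, and this product is congruent to the original one.\<close>

lemma op_of_rel_complex_op:
  assumes alg: "finitary_algebra A \<Omega> ar I" and w: "w \<in> \<Omega>"
    and Ts: "length Ts = ar w" "set Ts \<subseteq> fin_pow A"
  shows "complex_op (I w) (map (op_of_rel A \<Theta>) Ts) \<subseteq> op_of_rel A \<Theta> (complex_op (I w) Ts)"
proof -
  have "I w xs \<in> op_of_rel A \<Theta> (complex_op (I w) Ts)"
    if "xs \<in> listset (map (op_of_rel A \<Theta>) Ts)" for xs
  proof -
    have l: "list_all2 (\<lambda>x T. x \<in> op_of_rel A \<Theta> T) xs Ts"
      using that by (simp add: in_listset_iff list_all2_map2)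
    \<comment> \<open>Enlarging each argument set by the corresponding entry of \<open>xs\<close>
      keeps it in its congruence class, while putting \<open>xs\<close> into the product.\<close>
    define Ss where "Ss = map2 (\<lambda>x T. T \<union> {x}) xs Ts"
    have len: "length xs = ar w" using l Ts(1) by (simp add: list_all2_lengthD)
    have rel: "list_all2 (\<lambda>S T. (S, T) \<in> \<Theta>) Ss Ts"
      using l Ts op_of_rel_fin_iff
      by (auto simp: Ss_def list_all2_conv_all_nth subset_iff)
    have "set Ss \<subseteq> fin_pow A"
      using rel Con_fin_pow(1) by (simp add: list_all2_conv_all_nth subset_iff in_set_conv_nth) metis
    moreover have lenS: "length Ss = ar w" using len Ts(1) by (simp add: Ss_def)
    ultimately have S: "complex_op (I w) Ss \<in> fin_pow A"
      using complex_op_fin_pow[OF alg w] by blast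
    have T: "complex_op (I w) Ts \<in> fin_pow A" using complex_op_fin_pow[OF alg w Ts] .
    have "(complex_op (I w) Ss, complex_op (I w) Ts) \<in> \<Theta>"
      using \<Theta> w lenS Ts(1) rel by (auto simp: Con_def congruence_def)
    then have eq: "op_of_rel A \<Theta> (complex_op (I w) Ss) = op_of_rel A \<Theta> (complex_op (I w) Ts)"
      using rel_iff_op_of_rel_eq[OF S T] by simp
    have "xs \<in> listset Ss"
      using len Ts(1) by (auto simp: in_listset_iff Ss_def list_all2_conv_all_nth)
    then have "I w xs \<in> complex_op (I w) Ss" by (auto simp: complex_op_def)
    then show ?thesis
      using op_of_rel_increasing[of "complex_op (I w) Ss"] S eq by (auto simp: fin_pow_def)
  qed
  then show ?thesis by (auto simp: complex_op_def)
qed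

lemma op_of_rel_in_Clo:
  assumes "finitary_algebra A \<Omega> ar I"
  shows "op_of_rel A \<Theta> \<in> Clo A \<Omega> ar I"
proof -
  have "op_of_rel A \<Theta> \<in> extensional (Pow A)" by (simp add: op_of_rel_def)
  then have "op_of_rel A \<Theta> \<in> Pow A \<rightarrow>\<^sub>E Pow A"
    using op_of_rel_subset by (auto simp: PiE_def)
  then have "closure_operator A (op_of_rel A \<Theta>)"
    unfolding closure_operator_def
    using op_of_rel_increasing op_of_rel_mono op_of_rel_idem by (intro conjI ballI impI) auto
  moreover have "op_of_rel A \<Theta> {} = {}" by (auto simp: op_of_rel_iff fin_pow_def)
  moreover have "\<forall>B\<in>Pow A. op_of_rel A \<Theta> B = (\<Union>F\<in>fin_pow B. op_of_rel A \<Theta> F)"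
    using op_of_rel_algebraic by blast
  ultimately show ?thesis
    using op_of_rel_complex_op[OF assms] unfolding Clo_def by blast
qed

lemma rel_of_op_op_of_rel: "rel_of_op A (op_of_rel A \<Theta>) = \<Theta>"
proof (intro set_eqI iffI; clarify)
  fix Q R
  show "(Q, R) \<in> \<Theta>" if "(Q, R) \<in> rel_of_op A (op_of_rel A \<Theta>)"
    using that rel_iff_op_of_rel_eq by (simp add: rel_of_op_def)
  show "(Q, R) \<in> rel_of_op A (op_of_rel A \<Theta>)" if "(Q, R) \<in> \<Theta>"
    using that rel_iff_op_of_rel_eq[OF Con_fin_pow[OF that]] Con_fin_pow[OF that]
    by (simp add: rel_of_op_def)
qed

end

section \<open>The relation of a closure operator\<close>

lemma closure_increasing: "closure_operator A C \<Longrightarrow> T \<subseteq> A \<Longrightarrow> T \<subseteq> C T"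
  by (simp add: closure_operator_def)

lemma closure_mono: "closure_operator A C \<Longrightarrow> S \<subseteq> T \<Longrightarrow> T \<subseteq> A \<Longrightarrow> C S \<subseteq> C T"
  unfolding closure_operator_def by (meson PowI subset_trans)

text \<open>Monotonicity and idempotence give one direction, extensivity the other. Inclusions
  between closures are thereby reduced to generators.\<close>

lemma closure_subset_iff:
  assumes "closure_operator A C" "S \<subseteq> A" "T \<subseteq> A"
  shows "C S \<subseteq> C T \<longleftrightarrow> S \<subseteq> C T"
proof -
  have CT: "C T \<subseteq> A"
    using assms by (auto simp: closure_operator_def)
  have "C (C T) = C T"
    using assms by (simp add: closure_operator_def)
  then show ?thesis
    using closure_increasing[OF assms(1,2)] closure_mono[OF assms(1) _ CT, of S] by (metis subset_trans)
qed

text \<open>One half of compatibility with unions; the other follows by exchanging the primed and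
  unprimed sets.\<close>

lemma closure_Un_subset:
  assumes C: "closure_operator A C" and sub: "Q \<subseteq> A" "Q' \<subseteq> A" "R \<subseteq> A" "R' \<subseteq> A"
    and eq: "C Q = C Q'" "C R = C R'"
  shows "C (Q \<union> R) \<subseteq> C (Q' \<union> R')"
proof -
  have "C Q' \<subseteq> C (Q' \<union> R')" "C R' \<subseteq> C (Q' \<union> R')"
    using closure_mono[OF C] sub by simp_all
  then have "Q \<union> R \<subseteq> C (Q' \<union> R')" using eq closure_increasing[OF C] sub by blast
  then show ?thesis using closure_subset_iff[OF C] sub by (metis Un_least)
qed

text \<open>Each entry of \<open>Ts\<close> lies in the closure of its partner in \<open>Ss\<close>,
  and the defining condition of \<open>Clo\<close> moves these closures outside the operation. The
  reverse inclusion comes from swapping the lists.\<close>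

lemma rel_of_op_complex_op:
  assumes alg: "finitary_algebra A \<Omega> ar I" and C: "C \<in> Clo A \<Omega> ar I" and w: "w \<in> \<Omega>"
    and pos: "ar w > 0" and Ts: "length Ts = ar w" and Ss: "length Ss = ar w"
    and rel: "list_all2 (\<lambda>T S. (T, S) \<in> rel_of_op A C) Ts Ss"
  shows "C (complex_op (I w) Ts) \<subseteq> C (complex_op (I w) Ss)"
proof -
  have cl: "closure_operator A C" using C by (simp add: Clo_def)
  have fin: "set Ts \<subseteq> fin_pow A" "set Ss \<subseteq> fin_pow A"
    using rel by (auto simp: list_all2_conv_all_nth rel_of_op_def in_set_conv_nth)
  have "T \<subseteq> C S" if "(T, S) \<in> rel_of_op A C" for T S
    using that closure_increasing[OF cl, of T] by (auto simp: rel_of_op_def fin_pow_def)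
  then have "list_all2 (\<subseteq>) Ts (map C Ss)"
    using rel by (simp add: list_all2_conv_all_nth)
  then have "complex_op (I w) Ts \<subseteq> complex_op (I w) (map C Ss)" by (rule complex_op_mono)
  also have "\<dots> \<subseteq> C (complex_op (I w) Ss)"
    using C w pos Ss fin(2) by (simp add: Clo_def)
  finally have "complex_op (I w) Ts \<subseteq> C (complex_op (I w) Ss)" .
  moreover have "complex_op (I w) Ts \<subseteq> A" "complex_op (I w) Ss \<subseteq> A"
    using complex_op_fin_pow[OF alg w] Ts Ss fin by (simp_all add: fin_pow_def)
  ultimately show ?thesis using closure_subset_iff[OF cl] by blast
qed

lemma rel_of_op_in_Con:
  assumes alg: "finitary_algebra A \<Omega> ar I" and C: "C \<in> Clo A \<Omega> ar I"
  shows "rel_of_op A C \<in> Con A \<Omega> ar I"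
proof -
  have cl: "closure_operator A C" using C by (simp add: Clo_def)
  have eqv: "equiv (fin_pow A) (rel_of_op A C)"
    by (rule equivI) (auto simp: rel_of_op_def refl_on_def sym_def trans_def)
  have sym: "list_all2 (\<lambda>T S. (T, S) \<in> rel_of_op A C) Ss Ts"
    if "list_all2 (\<lambda>T S. (T, S) \<in> rel_of_op A C) Ts Ss" for Ts Ss
    using that by (auto simp: list_all2_conv_all_nth rel_of_op_def)
  have "(complex_op (I w) Ts, complex_op (I w) Ss) \<in> rel_of_op A C"
    if w: "w \<in> \<Omega>" and len: "length Ts = ar w" "length Ss = ar w"
      and rel: "list_all2 (\<lambda>T S. (T, S) \<in> rel_of_op A C) Ts Ss" for w Ts Ss
  proof -
    have "set Ts \<subseteq> fin_pow A" "set Ss \<subseteq> fin_pow A"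
      using rel by (auto simp: list_all2_conv_all_nth rel_of_op_def in_set_conv_nth)
    then have fin: "complex_op (I w) Ts \<in> fin_pow A" "complex_op (I w) Ss \<in> fin_pow A"
      using complex_op_fin_pow[OF alg w] len by simp_all
    have "C (complex_op (I w) Ts) = C (complex_op (I w) Ss)"
    \<comment> \<open>The condition in \<open>Clo\<close> speaks of positive arities only. For a
      constant both lists are empty, so the two complex values coincide.\<close>
    proof (cases "ar w = 0")
      case True
      then show ?thesis using len by simp
    next
      case False
      then show ?thesis
        using rel_of_op_complex_op[OF alg C w] len rel sym[OF rel] by (simp add: subset_antisym)
    qed
    with fin show ?thesis by (simp add: rel_of_op_def)
  qed
  moreover have "(Q \<union> R, Q' \<union> R') \<in> rel_of_op A C"
    if "(Q, Q') \<in> rel_of_op A C" "(R, R') \<in> rel_of_op A C" for Q Q' R R'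
  proof -
    have "Q \<subseteq> A" "Q' \<subseteq> A" "R \<subseteq> A" "R' \<subseteq> A" "C Q = C Q'" "C R = C R'"
      using that by (auto simp: rel_of_op_def fin_pow_def)
    then have "C (Q \<union> R) = C (Q' \<union> R')"
      using closure_Un_subset[OF cl] by (simp add: subset_antisym)
    then show ?thesis using that by (simp add: rel_of_op_def fin_pow_Un)
  qed
  ultimately show ?thesis using eqv by (simp add: Con_def congruence_def)
qed

text \<open>Both operators are extensional on \<open>Pow A\<close>, so it suffices to compare them
  on a subset \<open>T\<close>. There the left side collects the sets \<open>C U\<close> over the
  finite nonempty \<open>U\<close> in \<open>T\<close>, and algebraicity identifies their union with
  \<open>C T\<close>.\<close>

lemma op_of_rel_rel_of_op:
  assumes C: "C \<in> Clo A \<Omega> ar I"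
  shows "op_of_rel A (rel_of_op A C) = C"
proof (rule extensionalityI[where A = "Pow A"])
  have cl: "closure_operator A C" using C by (simp add: Clo_def)
  then have ext: "C \<in> Pow A \<rightarrow>\<^sub>E Pow A" by (simp add: closure_operator_def)
  then show "C \<in> extensional (Pow A)" by (simp add: PiE_def)
  show "op_of_rel A (rel_of_op A C) \<in> extensional (Pow A)" by (simp add: op_of_rel_def)
  fix T assume "T \<in> Pow A"
  then have T: "T \<subseteq> A" by simp
  \<comment> \<open>Adjoining \<open>a\<close> leaves the closure of \<open>U\<close> unchanged
    exactly when \<open>a\<close> already belongs to it.\<close>
  have step: "(U \<union> {a}, U) \<in> rel_of_op A C \<longleftrightarrow> a \<in> C U"
    if U: "U \<in> fin_pow T" and a: "a \<in> A" for U a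
  proof -
    have UA: "U \<in> fin_pow A" "U \<subseteq> A" using U T by (auto simp: fin_pow_def)
    have "C U \<subseteq> C (U \<union> {a})" "U \<subseteq> C U"
      using closure_mono[OF cl, of U "U \<union> {a}"] closure_increasing[OF cl, of U] UA(2) a by auto
    then have "C (U \<union> {a}) = C U \<longleftrightarrow> a \<in> C U"
      using closure_subset_iff[OF cl, of "U \<union> {a}" U] UA(2) a by auto
    moreover have "U \<union> {a} \<in> fin_pow A" using UA(1) a by (auto simp: fin_pow_def)
    ultimately show ?thesis using UA(1) by (simp add: rel_of_op_def)
  qed
  have CT: "C T = (\<Union>U\<in>fin_pow T. C U)" "C T \<subseteq> A"
    using C T PiE_mem[OF ext, of T] by (simp_all add: Clo_def)
  have "op_of_rel A (rel_of_op A C) T = {a \<in> A. \<exists>U\<in>fin_pow T. a \<in> C U}"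
    using T step by (auto simp: op_of_rel_def)
  then show "op_of_rel A (rel_of_op A C) T = C T" using CT by blast
qed

theorem theorem3p6:
  fixes A :: "'a set" and \<Omega> :: "'w set" and ar :: "'w \<Rightarrow> nat" and I :: "'w \<Rightarrow> 'a list \<Rightarrow> 'a"
  assumes "finitary_algebra A \<Omega> ar I"
  shows "bij_betw (op_of_rel A) (Con A \<Omega> ar I) (Clo A \<Omega> ar I)
       \<and> bij_betw (rel_of_op A) (Clo A \<Omega> ar I) (Con A \<Omega> ar I)
       \<and> (\<forall>\<Theta>\<in>Con A \<Omega> ar I. \<Theta> = rel_of_op A (op_of_rel A \<Theta>))
       \<and> (\<forall>C\<in>Clo A \<Omega> ar I. C = op_of_rel A (rel_of_op A C))"
proof -
  have toClo: "op_of_rel A ` Con A \<Omega> ar I \<subseteq> Clo A \<Omega> ar I"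
    using op_of_rel_in_Clo assms by blast
  have toCon: "rel_of_op A ` Clo A \<Omega> ar I \<subseteq> Con A \<Omega> ar I"
    using rel_of_op_in_Con[OF assms] by blast
  have Con: "\<forall>\<Theta>\<in>Con A \<Omega> ar I. rel_of_op A (op_of_rel A \<Theta>) = \<Theta>"
    by (intro ballI) (rule rel_of_op_op_of_rel)
  have Clo: "\<forall>C\<in>Clo A \<Omega> ar I. op_of_rel A (rel_of_op A C) = C"
    by (intro ballI) (rule op_of_rel_rel_of_op)
  show ?thesis
    using bij_betw_byWitness[OF Con Clo toClo toCon] bij_betw_byWitness[OF Clo Con toCon toClo]
      Con Clo by simp
qed

end
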